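(* For any parameter $\mathbf{w}\in\mathbb{R}^D$, suppose the set of parameters that generate the same predictions is denoted by $$\mathcal{P}_{\mathbf{w}}^\perp=\{\mathbf{w}'\in\mathbb{R}^D \text{ such that } f(\mathbf{w}',\mathbf{x})=f(\mathbf{w},\mathbf{x})\text{ for all }\mathbf{x}\in\mathcal{X}\}.$$ Then this set is a smooth manifold embedded in $\mathbb{R}^D$. Furthermore, the set $\mathcal{P}_{\mathbf{w}}$ of parameters that locally generates unique predictions (see the context) is also a submanifold embedded in $\mathbb{R}^D$.
   Context: Setting. $f:\mathbb{R}^D\times\mathbb{R}^I\to\mathbb{R}^O$, $(\mathbf{w},\mathbf{x})\mapsto f(\mathbf{w},\mathbf{x})$, is a neural network with parameters $\mathbf{w}$, and $\mathcal{X}=\{\mathbf{x}_1,\ldots,\mathbf{x}_N\}\subset\mathbb{R}^I$ is a finite training set. Let $\mathfrak{F}:\mathbb{R}^D\to\mathbb{R}^{NO}$, $\mathfrak{F}(\mathbf{w})=(f(\mathbf{w},\mathbf{x}_1),\ldots,f(\mathbf{w},\mathbf{x}_N))$, with differential $\mathbf{J}_{\mathbf{w}}=\nabla_{\mathbf{w}}\mathfrak{F}|_{\mathbf{w}}\in\mathbb{R}^{NO\times D}$, the stacking of the per-datum Jacobians. Standing assumption. The setting is overparametrized, $D>NO$, and the Jacobian $\mathbf{J}_{\mathbf{w}}$ has full rank (hence is surjective) at every $\mathbf{w}\in\mathbb{R}^D$. The set $\mathcal{P}_{\mathbf{w}}$. Fix $\mathbf{w}$ and reorder the coordinates of $\mathbb{R}^D$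 so that the first $NO$ columns of $\mathbf{J}_{\mathbf{w}}$ are linearly independent. Consider the map $$\alpha(v_1,\ldots,v_D)=(\mathfrak{F}(v)_1,\ldots,\mathfrak{F}(v)_{NO},v_{NO+1},\ldots,v_D).$$ Its differential at $\mathbf{w}$ is non-singular, so by the inverse function theorem there is an open $W\subseteq\mathbb{R}^D$ containing $\mathbf{w}$ such that $\alpha|_W:W\to\alpha(W)$ is smooth with smooth inverse. The set of parameters that locally generates unique predictions is $$\mathcal{P}_{\mathbf{w}}=\{\alpha^{-1}(p_1,\ldots,p_{NO},\underbrace{0,\ldots,0}_{D-NO}) \text{ for } p\in\mathbb{R}^{NO}\}\subseteq\mathbb{R}^D.$$ *)

theory Defs
  imports "HOL-Analysis.Analysis"
begin

text \<open>Only meant for open \<open>S\<close>, where it is the usual class \<open>C\<^sup>n\<close>: all iterated directional derivatives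
  up to order \<open>n\<close> exist as Frechet derivatives and are continuous.\<close>

primrec n_times_differentiable_on ::
  "nat \<Rightarrow> 'a::real_normed_vector set \<Rightarrow> ('a \<Rightarrow> 'b::real_normed_vector) \<Rightarrow> bool" where
  "n_times_differentiable_on 0 S f \<longleftrightarrow> continuous_on S f"
| "n_times_differentiable_on (Suc n) S f \<longleftrightarrow>
     (\<forall>x\<in>S. f differentiable (at x)) \<and>
     (\<forall>v. n_times_differentiable_on n S (\<lambda>x. frechet_derivative f (at x) v))"

definition smooth_on :: "'a::real_normed_vector set \<Rightarrow> ('a \<Rightarrow> 'b::real_normed_vector) \<Rightarrow> bool" where
  "smooth_on S f \<longleftrightarrow> (\<forall>n. n_times_differentiable_on n S f)"

definition diffeo_onto_image ::
  "'a::real_normed_vector set \<Rightarrow> ('a \<Rightarrow> 'b::real_normed_vector) \<Rightarrow> bool" where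
  "diffeo_onto_image U g \<longleftrightarrow>
     open U \<and> inj_on g U \<and> open (g ` U) \<and> smooth_on U g \<and> smooth_on (g ` U) (the_inv_into U g)"

text \<open>Embedded (regular) submanifolds of \<open>\<real>\<^sup>D\<close> by adapted charts: around each point there is a chart
  \<open>\<phi>\<close> of the ambient space in which \<open>S\<close> is the common zero set of all but \<open>k\<close> of the coordinate
  functions. As usual, the empty set is a submanifold (of every dimension).\<close>

definition embedded_submanifold_of_dim :: "nat \<Rightarrow> (real ^ 'd) set \<Rightarrow> bool" where
  "embedded_submanifold_of_dim k S \<longleftrightarrow>
     (\<forall>p\<in>S. \<exists>U (\<phi> :: real ^ 'd \<Rightarrow> real ^ 'd) K.
        p \<in> U \<and> diffeo_onto_image U \<phi> \<and> card K = k \<and>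
        U \<inter> S = {x \<in> U. \<forall>j. j \<notin> K \<longrightarrow> \<phi> x $ j = 0})"

definition embedded_submanifold :: "(real ^ 'd) set \<Rightarrow> bool" where
  "embedded_submanifold S \<longleftrightarrow> (\<exists>k. embedded_submanifold_of_dim k S)"

text \<open>The map \<open>\<FF>\<close>. The training set is enumerated by \<open>xs\<close>, and the \<open>N O\<close> coordinates of the stacked
  prediction vector are indexed by pairs of a datum and an output component.\<close>

definition stacked ::
  "(real ^ 'd \<Rightarrow> real ^ 'i \<Rightarrow> real ^ 'o) \<Rightarrow> ('n::finite \<Rightarrow> real ^ 'i) \<Rightarrow> real ^ 'd \<Rightarrow> real ^ ('n \<times> 'o)" where
  "stacked f xs w = (\<chi> k. f w (xs (fst k)) $ snd k)"

text \<open>A reordering of the coordinates of \<open>\<real>\<^sup>D\<close> is encoded by the injection \<open>e\<close> telling which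
  coordinates become the first \<open>N O\<close> ones; the order of the remaining ones is immaterial.
  Injectivity of the column map makes linear independence one of families, not just of sets.\<close>

definition admissible_reordering ::
  "real ^ 'd ^ 'k \<Rightarrow> ('k::finite \<Rightarrow> 'd) \<Rightarrow> bool" where
  "admissible_reordering J e \<longleftrightarrow>
     inj e \<and> inj (\<lambda>k. column (e k) J) \<and> independent (range (\<lambda>k. column (e k) J))"

text \<open>The vector \<open>(p\<^sub>1, \<dots>, p\<^bsub>NO\<^esub>, v\<^bsub>NO+1\<^esub>, \<dots>, v\<^sub>D)\<close>, written in the original coordinate order.\<close>

definition join_coords ::
  "('k::finite \<Rightarrow> 'd) \<Rightarrow> real ^ 'k \<Rightarrow> real ^ 'd \<Rightarrow> real ^ 'd" where
  "join_coords e p v = (\<chi> j. if j \<in> range e then p $ (inv e j) else v $ j)"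

definition alpha ::
  "(real ^ 'd \<Rightarrow> real ^ 'k) \<Rightarrow> ('k::finite \<Rightarrow> 'd) \<Rightarrow> real ^ 'd \<Rightarrow> real ^ 'd" where
  "alpha F e v = join_coords e (F v) v"

definition alpha_domain ::
  "(real ^ 'd \<Rightarrow> real ^ 'k) \<Rightarrow> ('k::finite \<Rightarrow> 'd) \<Rightarrow> real ^ 'd \<Rightarrow> (real ^ 'd) set \<Rightarrow> bool" where
  "alpha_domain F e w W \<longleftrightarrow> w \<in> W \<and> diffeo_onto_image W (alpha F e)"

text \<open>\<open>\<alpha>\<^sup>-\<^sup>1\<close> is the inverse of \<open>\<alpha>\<close> restricted to \<open>W\<close>, so only those \<open>p\<close> count for which
  \<open>(p, 0)\<close> lies in its domain \<open>\<alpha>(W)\<close>.\<close>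

definition unique_predictions ::
  "(real ^ 'd \<Rightarrow> real ^ 'k) \<Rightarrow> ('k::finite \<Rightarrow> 'd) \<Rightarrow> (real ^ 'd) set \<Rightarrow> (real ^ 'd) set" where
  "unique_predictions F e W =
     {the_inv_into W (alpha F e) (join_coords e p 0) | p. join_coords e p 0 \<in> alpha F e ` W}"

definition same_predictions ::
  "(real ^ 'd \<Rightarrow> real ^ 'i \<Rightarrow> real ^ 'o) \<Rightarrow> (real ^ 'i) set \<Rightarrow> real ^ 'd \<Rightarrow> (real ^ 'd) set" where
  "same_predictions f X w = {w'. \<forall>x\<in>X. f w' x = f w x}"

end

theory Submission
  imports Defs
begin

text \<open>Full rank of the Jacobian at \<open>p\<close> yields an admissible reordering \<open>e\<close> of the coordinates, and then the
  derivative of \<open>\<alpha>\<close> at \<open>p\<close> is injective, so \<open>\<alpha>\<close> is a local diffeomorphism at \<open>p\<close>. Translated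
  by the vector with the values to be attained in the coordinates from \<open>e\<close>, it is an adapted chart for the
  level set of \<open>\<FF>\<close> through \<open>p\<close>, cut out by those coordinates. Untranslated, it is an adapted chart
  for \<open>P\<^sub>w\<close>, cut out by the remaining ones.

  The library's inverse function theorem gives only a differentiable inverse \<open>g\<close>. By Cramer's rule \<open>Dg\<close> is a
  rational expression in the entries of \<open>D\<alpha> \<circ> g\<close>, so it is \<open>C\<^sup>n\<close> whenever \<open>g\<close> is, and \<open>g\<close> is
  smooth by induction.\<close>

section \<open>Calculus of C^n maps on open sets\<close>

lemma n_times_differentiable_on_cong:
  assumes "open S" "n_times_differentiable_on n S f" "\<And>x. x \<in> S \<Longrightarrow> f x = g x"
  shows "n_times_differentiable_on n S g"
  using assms(2,3)
proof (induction n arbitrary: f g)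
  case 0
  then show ?case
    unfolding n_times_differentiable_on.simps(1) by (blast intro: continuous_on_eq)
next
  case (Suc n)
  have der: "(g has_derivative frechet_derivative f (at x)) (at x)" if "x \<in> S" for x
  proof (rule has_derivative_transform_within_open[OF _ \<open>open S\<close> that Suc.prems(2)])
    show "(f has_derivative frechet_derivative f (at x)) (at x)"
      using Suc.prems(1) that by (simp flip: frechet_derivative_works)
  qed
  have "frechet_derivative f (at x) v = frechet_derivative g (at x) v" if "x \<in> S" for x v
    using frechet_derivative_at[OF der[OF that]] by simp
  then have "n_times_differentiable_on n S (\<lambda>x. frechet_derivative g (at x) v)" for v
    using Suc.prems(1) by - (rule Suc.IH[of "\<lambda>x. frechet_derivative f (at x) v"], simp_all)
  then show ?case
    using der[THEN differentiableI] by simp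
qed

text \<open>Lets an explicit derivative formula stand in for \<open>frechet_derivative\<close>, by
  uniqueness of derivatives. Each closure property below then amounts to one differentiation rule
  and an induction on the order.\<close>

lemma n_times_differentiable_on_SucI:
  assumes "open S" "\<And>x. x \<in> S \<Longrightarrow> (f has_derivative f' x) (at x)"
    and "\<And>v. n_times_differentiable_on n S (\<lambda>x. f' x v)"
  shows "n_times_differentiable_on (Suc n) S f"
proof -
  have eq: "f' x v = frechet_derivative f (at x) v" if "x \<in> S" for x v
    using frechet_derivative_at[OF assms(2)[OF that]] by simp
  have "n_times_differentiable_on n S (\<lambda>x. frechet_derivative f (at x) v)" for v
    by (rule n_times_differentiable_on_cong[OF assms(1) assms(3)[of v]]) (simp add: eq)
  then show ?thesis
    using assms(2)[THEN differentiableI] by simp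
qed

lemma n_times_differentiable_on_has_derivative:
  assumes "n_times_differentiable_on (Suc n) S f" "x \<in> S"
  shows "(f has_derivative frechet_derivative f (at x)) (at x)"
  using assms by (simp flip: frechet_derivative_works)

text \<open>Needed because product and chain rules mix differentiated and undifferentiated factors:
  the latter must be brought down to the order of the former.\<close>

lemma n_times_differentiable_on_SucD:
  "n_times_differentiable_on (Suc n) S f \<Longrightarrow> n_times_differentiable_on n S f"
proof (induction n arbitrary: f)
  case 0
  then show ?case
    by (auto intro!: differentiable_imp_continuous_on simp: differentiable_on_def differentiable_at_withinI)
next
  case (Suc n)
  have "n_times_differentiable_on n S (\<lambda>x. frechet_derivative f (at x) v)" for v
    using Suc.prems by (intro Suc.IH) simp
  then show ?case
    using Suc.prems by simp
qed

lemma n_times_differentiable_on_subset: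
  "n_times_differentiable_on n S f \<Longrightarrow> T \<subseteq> S \<Longrightarrow> n_times_differentiable_on n T f"
  by (induction n arbitrary: f) (auto intro: continuous_on_subset)

lemma n_times_differentiable_on_const:
  "n_times_differentiable_on n S (\<lambda>x. c)"
  \<comment> \<open>The derivative of a constant is another constant, 0, so \<open>c\<close> has to
    vary.\<close>
  by (induction n arbitrary: c) auto

lemma n_times_differentiable_on_id:
  assumes "open S"
  shows "n_times_differentiable_on n S (\<lambda>x. x)"
proof (cases n)
  case (Suc m)
  have "n_times_differentiable_on (Suc m) S (\<lambda>x. x)"
    by (rule n_times_differentiable_on_SucI[OF assms has_derivative_ident])
       (rule n_times_differentiable_on_const)
  then show ?thesis using Suc by blast
qed simp

lemma n_times_differentiable_on_add:
  assumes "open S" "n_times_differentiable_on n S f" "n_times_differentiable_on n S g"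
  shows "n_times_differentiable_on n S (\<lambda>x. f x + g x)"
  using assms(2,3)
proof (induction n arbitrary: f g)
  case 0
  then show ?case by (simp add: continuous_on_add)
next
  case (Suc n)
  show ?case
    by (rule n_times_differentiable_on_SucI[OF \<open>open S\<close>],
        rule has_derivative_add[OF Suc.prems[THEN n_times_differentiable_on_has_derivative]])
       (use Suc.prems in \<open>simp_all add: Suc.IH\<close>)
qed

lemma n_times_differentiable_on_sum:
  assumes "open S" "\<And>i. i \<in> I \<Longrightarrow> n_times_differentiable_on n S (f i)"
  shows "n_times_differentiable_on n S (\<lambda>x. \<Sum>i\<in>I. f i x)"
  using assms(2)
  \<comment> \<open>Over an infinite \<open>I\<close> the sum is 0 by convention, again a
    constant.\<close>
  by (induction I rule: infinite_finite_induct)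
     (auto intro: n_times_differentiable_on_add n_times_differentiable_on_const \<open>open S\<close>)

lemma n_times_differentiable_on_bilinear:
  assumes "bounded_bilinear h" "open S"
    and "n_times_differentiable_on n S f" "n_times_differentiable_on n S g"
  shows "n_times_differentiable_on n S (\<lambda>x. h (f x) (g x))"
  using assms(3,4)
proof (induction n arbitrary: f g)
  case 0
  then show ?case by (simp add: bounded_bilinear.continuous_on[OF assms(1)])
next
  case (Suc n)
  show ?case
  proof (rule n_times_differentiable_on_SucI[OF \<open>open S\<close>])
    show "((\<lambda>x. h (f x) (g x)) has_derivative
        (\<lambda>v. h (f x) (frechet_derivative g (at x) v) + h (frechet_derivative f (at x) v) (g x))) (at x)"
      if "x \<in> S" for x
      using bounded_bilinear.FDERIV[OF assms(1) Suc.prems[THEN n_times_differentiable_on_has_derivative[OF _ that]]] .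
    show "n_times_differentiable_on n S
        (\<lambda>x. h (f x) (frechet_derivative g (at x) v) + h (frechet_derivative f (at x) v) (g x))" for v
      using Suc.prems Suc.prems[THEN n_times_differentiable_on_SucD]
      by (intro n_times_differentiable_on_add Suc.IH \<open>open S\<close>) simp_all
  qed
qed

lemmas n_times_differentiable_on_scaleR =
  n_times_differentiable_on_bilinear[OF bounded_bilinear_scaleR]

lemmas n_times_differentiable_on_mult =
  n_times_differentiable_on_bilinear[OF bounded_bilinear_mult]

lemma n_times_differentiable_on_linear:
  assumes "bounded_linear h" "open S" "n_times_differentiable_on n S f"
  shows "n_times_differentiable_on n S (\<lambda>x. h (f x))"
  using assms(3)
proof (induction n arbitrary: f)
  case 0
  then show ?case by (simp add: bounded_linear.continuous_on[OF assms(1)])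
next
  case (Suc n)
  show ?case
    by (rule n_times_differentiable_on_SucI[OF \<open>open S\<close>],
        rule bounded_linear.has_derivative[OF assms(1) Suc.prems[THEN n_times_differentiable_on_has_derivative]])
       (use Suc.prems in \<open>simp_all add: Suc.IH\<close>)
qed

lemma n_times_differentiable_on_prod:
  fixes f :: "'i \<Rightarrow> 'a::real_normed_vector \<Rightarrow> real"
  assumes "open S" "\<And>i. i \<in> I \<Longrightarrow> n_times_differentiable_on n S (f i)"
  shows "n_times_differentiable_on n S (\<lambda>x. \<Prod>i\<in>I. f i x)"
  using assms(2)
  by (induction I rule: infinite_finite_induct)
     (auto intro: n_times_differentiable_on_mult n_times_differentiable_on_const \<open>open S\<close>)

text \<open>The derivative of 1/f is a product of Df with two copies of 1/f itself, so
  \<open>f\<close> stays fixed and the induction hypothesis for 1/f at order \<open>n\<close> feeds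
  the step.\<close>

lemma n_times_differentiable_on_inverse:
  fixes f :: "'a::real_normed_vector \<Rightarrow> real"
  assumes "open S" "\<And>x. x \<in> S \<Longrightarrow> f x \<noteq> 0" "n_times_differentiable_on n S f"
  shows "n_times_differentiable_on n S (\<lambda>x. inverse (f x))"
  using assms(3)
proof (induction n)
  case 0
  then show ?case using assms(2) by (auto intro: continuous_on_inverse)
next
  case (Suc n)
  have IH: "n_times_differentiable_on n S (\<lambda>x. inverse (f x))"
    using Suc.IH n_times_differentiable_on_SucD[OF Suc.prems] by blast
  show ?case
  proof (rule n_times_differentiable_on_SucI[OF \<open>open S\<close>])
    show "((\<lambda>x. inverse (f x)) has_derivative
        (\<lambda>v. - (inverse (f x) * frechet_derivative f (at x) v * inverse (f x)))) (at x)"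
      if "x \<in> S" for x
      using Deriv.has_derivative_inverse[OF assms(2)[OF that]
        n_times_differentiable_on_has_derivative[OF Suc.prems that]] .
    show "n_times_differentiable_on n S
        (\<lambda>x. - (inverse (f x) * frechet_derivative f (at x) v * inverse (f x)))" for v
      using Suc.prems
      by (intro n_times_differentiable_on_linear[OF bounded_linear_minus[OF bounded_linear_ident]]
          n_times_differentiable_on_mult IH \<open>open S\<close>) simp
  qed
qed

lemma n_times_differentiable_on_compose:
  fixes f :: "'b::euclidean_space \<Rightarrow> 'c::real_normed_vector"
  assumes "open S" "open T" "g ` S \<subseteq> T"
    and "n_times_differentiable_on n T f" "n_times_differentiable_on n S g"
  shows "n_times_differentiable_on n S (\<lambda>x. f (g x))"
  using assms(4,5)
proof (induction n arbitrary: f)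
  case 0
  then show ?case using assms(3) by (auto intro: continuous_on_compose2)
next
  case (Suc n)
  note df = n_times_differentiable_on_has_derivative[OF Suc.prems(1)]
  note dg = n_times_differentiable_on_has_derivative[OF Suc.prems(2)]
  show ?case
  proof (rule n_times_differentiable_on_SucI[OF \<open>open S\<close>])
    \<comment> \<open>In the chain rule the direction fed to Df moves with \<open>x\<close>, while
      the induction hypothesis covers derivatives of \<open>f\<close> in fixed directions. Expanding
      the direction in the basis separates the two: scalar coefficients from Dg times the maps Df(g
      x) b.\<close>
    show "((\<lambda>x. f (g x)) has_derivative (\<lambda>v. \<Sum>b\<in>Basis.
        (frechet_derivative g (at x) v \<bullet> b) *\<^sub>R frechet_derivative f (at (g x)) b)) (at x)"
      if "x \<in> S" for x
    proof -
      have gx: "g x \<in> T" using that assms(3) by blast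
      note lin = has_derivative_linear[OF df[OF gx]]
      have "frechet_derivative f (at (g x)) u = (\<Sum>b\<in>Basis. (u \<bullet> b) *\<^sub>R frechet_derivative f (at (g x)) b)" for u
        using euclidean_representation[of u]
        by (metis (no_types, lifting) linear_scale[OF lin] linear_sum[OF lin] sum.cong)
      then have "(\<lambda>v. frechet_derivative f (at (g x)) (frechet_derivative g (at x) v)) = (\<lambda>v. \<Sum>b\<in>Basis.
          (frechet_derivative g (at x) v \<bullet> b) *\<^sub>R frechet_derivative f (at (g x)) b)"
        by (rule ext)
      with has_derivative_compose[OF dg[OF that] df[OF gx]] show ?thesis
        by (rule back_subst)
    qed
    show "n_times_differentiable_on n S (\<lambda>x. \<Sum>b\<in>Basis.
        (frechet_derivative g (at x) v \<bullet> b) *\<^sub>R frechet_derivative f (at (g x)) b)" for v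
      using Suc.prems n_times_differentiable_on_SucD[OF Suc.prems(2)]
      by (intro n_times_differentiable_on_sum n_times_differentiable_on_scaleR Suc.IH \<open>open S\<close>
          n_times_differentiable_on_linear[OF bounded_linear_inner_left]) auto
  qed
qed

lemma n_times_differentiable_on_vec:
  fixes f :: "'a::real_normed_vector \<Rightarrow> real ^ 'n"
  assumes "open S"
  shows "n_times_differentiable_on n S f \<longleftrightarrow> (\<forall>i. n_times_differentiable_on n S (\<lambda>x. f x $ i))"
proof
  assume "n_times_differentiable_on n S f"
  then show "\<forall>i. n_times_differentiable_on n S (\<lambda>x. f x $ i)"
    using n_times_differentiable_on_linear[OF bounded_linear_vec_nth assms] by blast
next
  assume R: "\<forall>i. n_times_differentiable_on n S (\<lambda>x. f x $ i)"
  have "n_times_differentiable_on n S (\<lambda>x. \<Sum>i\<in>UNIV. f x $ i *\<^sub>R (axis i 1 :: real ^ 'n))"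
    using R by (intro n_times_differentiable_on_sum n_times_differentiable_on_scaleR
        n_times_differentiable_on_const assms) auto
  moreover have "(\<Sum>i\<in>UNIV. f x $ i *\<^sub>R axis i 1) = f x" for x
    using basis_expansion[of "f x"] by (simp add: scalar_mult_eq_scaleR)
  ultimately show "n_times_differentiable_on n S f" by (simp only:)
qed

section \<open>Determinants and Cramer's rule with C^n entries\<close>

lemma n_times_differentiable_on_det:
  fixes A :: "'a::real_normed_vector \<Rightarrow> real ^ 'n ^ 'n"
  assumes "open S" "\<And>i j. n_times_differentiable_on n S (\<lambda>x. A x $ i $ j)"
  shows "n_times_differentiable_on n S (\<lambda>x. det (A x))"
  unfolding det_def
  by (intro n_times_differentiable_on_sum n_times_differentiable_on_mult
      n_times_differentiable_on_prod n_times_differentiable_on_const assms)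

text \<open>Cramer's rule writes each component of the solution as a quotient of determinants,
  polynomials in the entries of \<open>A\<close> and \<open>b\<close>, with nonvanishing
  denominator.\<close>

lemma n_times_differentiable_on_solution:
  fixes A :: "'a::real_normed_vector \<Rightarrow> real ^ 'n ^ 'n"
  assumes "open S" "\<And>i j. n_times_differentiable_on n S (\<lambda>x. A x $ i $ j)"
    and "\<And>i. n_times_differentiable_on n S (\<lambda>x. b x $ i)"
    and "\<And>x. x \<in> S \<Longrightarrow> det (A x) \<noteq> 0" "\<And>x. x \<in> S \<Longrightarrow> A x *v y x = b x"
  shows "n_times_differentiable_on n S y"
proof -
  have "n_times_differentiable_on n S
      (\<lambda>x. det (\<chi> i j. if j = k then b x $ i else A x $ i $ j) * inverse (det (A x)))" for k
  proof (intro n_times_differentiable_on_mult n_times_differentiable_on_det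
      n_times_differentiable_on_inverse assms)
    show "n_times_differentiable_on n S
        (\<lambda>x. (\<chi> i j. if j = k then b x $ i else A x $ i $ j) $ i $ j)" for i j
      using assms(2,3) by (cases "j = k") auto
  qed auto
  then have "n_times_differentiable_on n S (\<lambda>x. y x $ k)" for k
  proof (rule n_times_differentiable_on_cong[OF \<open>open S\<close>])
    fix x assume "x \<in> S"
    then have "y x = (\<chi> k. det (\<chi> i j. if j = k then b x $ i else A x $ i $ j) / det (A x))"
      using cramer[OF assms(4), of x "y x" "b x"] assms(5) by blast
    then show "det (\<chi> i j. if j = k then b x $ i else A x $ i $ j) * inverse (det (A x)) = y x $ k"
      by (simp add: divide_inverse)
  qed
  then show ?thesis
    using n_times_differentiable_on_vec[OF \<open>open S\<close>] by blast
qed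

section \<open>The inverse function theorem in the smooth category\<close>

lemma smooth_on_local_inverse:
  fixes f :: "real ^ 'n \<Rightarrow> real ^ 'n"
  assumes "open U" "open V" "smooth_on U f" "g ` V \<subseteq> U"
    and der: "\<And>y. y \<in> V \<Longrightarrow> (g has_derivative g' y) (at y)"
    and inv: "\<And>y v. y \<in> V \<Longrightarrow> frechet_derivative f (at (g y)) (g' y v) = v"
  shows "smooth_on V g"
  unfolding smooth_on_def
proof
  fix n
  have f: "n_times_differentiable_on m U f" for m
    using assms(3) by (simp add: smooth_on_def)
  define A where "A = (\<lambda>y. matrix (frechet_derivative f (at (g y))))"
  have lin: "linear (frechet_derivative f (at (g y)))" if "y \<in> V" for y
    using n_times_differentiable_on_has_derivative[OF f, of "g y"] that assms(4) has_derivative_linear by blast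
  have A: "A y *v u = frechet_derivative f (at (g y)) u" if "y \<in> V" for y u
    unfolding A_def using lin[OF that] by (simp add: matrix_works)
  \<comment> \<open>The relation \<open>inv\<close> is one-sided, but \<open>A y\<close> is square,
    so surjectivity already makes it invertible.\<close>
  have det: "det (A y) \<noteq> 0" if "y \<in> V" for y
  proof -
    have "surj ((*v) (A y))"
      using A[OF that] inv[OF that] by (metis surjI)
    then have "\<exists>B. A y ** B = mat 1"
      by (simp add: matrix_right_invertible_surjective)
    then show ?thesis
      by (metis invertible_det_nz invertible_right_inverse)
  qed
  show "n_times_differentiable_on n V g"
  proof (induction n)
    case 0
    show ?case
      using der by (auto intro!: continuous_at_imp_continuous_on has_derivative_continuous)
  next
    case (Suc n)
    show ?case
    proof (rule n_times_differentiable_on_SucI[OF \<open>open V\<close> der])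
      fix v
      \<comment> \<open>The entries of \<open>A\<close> are components of directional derivatives of
        \<open>f\<close> composed with \<open>g\<close>, which is C^n by induction. The vector
        \<open>g' y v\<close> solves the linear system with matrix \<open>A y\<close> and constant
        right-hand side \<open>v\<close>.\<close>
      have "n_times_differentiable_on n U (\<lambda>x. frechet_derivative f (at x) u)" for u
        using f[of "Suc n"] by simp
      from n_times_differentiable_on_compose[OF \<open>open V\<close> \<open>open U\<close> \<open>g ` V \<subseteq> U\<close> this Suc]
      have "n_times_differentiable_on n V (\<lambda>y. A y $ i $ j)" for i j
        by (simp add: A_def matrix_def n_times_differentiable_on_linear[OF bounded_linear_vec_nth \<open>open V\<close>])
      then show "n_times_differentiable_on n V (\<lambda>y. g' y v)"
        by (rule n_times_differentiable_on_solution[OF \<open>open V\<close> _ n_times_differentiable_on_const[of _ _ "v $ _"] det])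
           (simp_all add: A inv)
    qed
  qed
qed

lemma smooth_inverse_function_theorem:
  fixes f :: "real ^ 'n \<Rightarrow> real ^ 'n"
  assumes "open S" "p \<in> S" "smooth_on S f" "inj (frechet_derivative f (at p))"
  obtains U where "p \<in> U" "diffeo_onto_image U f"
proof -
  have f: "n_times_differentiable_on m S f" for m
    using assms(3) by (simp add: smooth_on_def)
  note df = n_times_differentiable_on_has_derivative[OF f]
  define f' where "f' = (\<lambda>x. Blinfun (frechet_derivative f (at x)))"
  have f': "blinfun_apply (f' x) = frechet_derivative f (at x)" if "x \<in> S" for x
    unfolding f'_def using df[OF that] has_derivative_bounded_linear
    by (blast intro: bounded_linear_Blinfun_apply)
  \<comment> \<open>In finite dimension, continuity in every fixed direction gives continuity in
    operator norm, the form the library theorem asks for.\<close>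
  have "continuous_on S (\<lambda>x. f' x v)" for v
    using f[of "Suc 0"] by (auto simp: f' cong: continuous_on_cong)
  then have cont: "continuous_on S f'"
    by (intro continuous_on_blinfun_componentwise)
  \<comment> \<open>Injectivity at \<open>p\<close> enters as a left inverse, which becomes the
    invertibility hypothesis of the library theorem.\<close>
  obtain L where L: "linear L" "L \<circ> frechet_derivative f (at p) = id"
    using linear_injective_left_inverse[OF _ assms(4)] df[OF \<open>p \<in> S\<close>] has_derivative_linear by blast
  have "Blinfun L o\<^sub>L f' p = id_blinfun"
    using L f'[OF \<open>p \<in> S\<close>]
    by (intro blinfun_eqI) (simp add: bounded_linear_Blinfun_apply linear_conv_bounded_linear pointfree_idE)
  then obtain U V g g' where UV: "open U" "U \<subseteq> S" "p \<in> U" "open V" "homeomorphism U V f g"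
    and g: "\<And>y. y \<in> V \<Longrightarrow> (g has_derivative g' y) (at y)"
      "\<And>y. y \<in> V \<Longrightarrow> g' y = inv (blinfun_apply (f' (g y)))"
      "\<And>y. y \<in> V \<Longrightarrow> bij (blinfun_apply (f' (g y)))"
    using inverse_function_theorem[OF \<open>open S\<close> _ cont \<open>p \<in> S\<close>] df f' by (metis (full_types))
  have img: "f ` U = V" "g ` V = U" "\<And>x. x \<in> U \<Longrightarrow> g (f x) = x"
    using UV(5) by (auto simp: homeomorphism_def)
  have inj: "inj_on f U"
    by (rule inj_on_inverseI) (rule img(3))
  have U: "smooth_on U f"
    using f UV(2) by (auto simp: smooth_on_def intro: n_times_differentiable_on_subset)
  have "smooth_on V g"
  proof (rule smooth_on_local_inverse[OF UV(1,4) U _ g(1)])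
    show "frechet_derivative f (at (g y)) (g' y v) = v" if "y \<in> V" for y v
    proof -
      have "g y \<in> S" using that img(2) UV(2) by blast
      then show ?thesis using g(2,3)[OF that] f' by (simp add: bij_is_surj surj_f_inv_f)
    qed
  qed (use img in auto)
  moreover have "g y = the_inv_into U f y" if "y \<in> V" for y
    using that img inj by (metis imageE the_inv_into_f_f)
  ultimately have "smooth_on (f ` U) (the_inv_into U f)"
    unfolding smooth_on_def img(1) using n_times_differentiable_on_cong[OF UV(4)] by blast
  then have "diffeo_onto_image U f"
    using UV img inj U by (simp add: diffeo_onto_image_def)
  then show thesis using that UV(3) by blast
qed

section \<open>The map \<alpha>: smoothness, derivative and admissible reorderings\<close>

lemma join_coords_split: "join_coords e p v = join_coords e p 0 + join_coords e 0 v"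
  by (simp add: join_coords_def vec_eq_iff)

lemma bounded_linear_join_coords_left: "bounded_linear (\<lambda>p. join_coords e p 0)"
  by (simp flip: linear_conv_bounded_linear)
     (auto intro!: linearI simp: join_coords_def vec_eq_iff)

lemma bounded_linear_join_coords_right: "bounded_linear (\<lambda>v. join_coords e 0 v)"
  by (simp flip: linear_conv_bounded_linear)
     (auto intro!: linearI simp: join_coords_def vec_eq_iff)

text \<open>The translation \<open>c\<close> serves the level-set chart, which must vanish in the
  selected coordinates; \<open>c = 0\<close> gives \<alpha> itself.\<close>

lemma smooth_on_alpha:
  assumes "smooth_on UNIV F"
  shows "smooth_on UNIV (\<lambda>v. alpha F e v - c)"
proof -
  have eq: "(\<lambda>v. alpha F e v - c) = (\<lambda>v. join_coords e (F v) 0 + join_coords e 0 v + (- c))"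
    unfolding alpha_def by (subst join_coords_split) simp
  show ?thesis
    unfolding smooth_on_def eq
    by (intro allI n_times_differentiable_on_add n_times_differentiable_on_const
        n_times_differentiable_on_linear[OF bounded_linear_join_coords_left]
        n_times_differentiable_on_linear[OF bounded_linear_join_coords_right]
        n_times_differentiable_on_id open_UNIV)
      (use assms in \<open>simp add: smooth_on_def\<close>)
qed

lemma has_derivative_alpha:
  assumes "(F has_derivative F') (at x)"
  shows "((\<lambda>v. alpha F e v - c) has_derivative (\<lambda>u. join_coords e (F' u) u)) (at x)"
proof -
  have "((\<lambda>v. join_coords e (F v) 0 + join_coords e 0 v - c) has_derivative
      (\<lambda>u. join_coords e (F' u) 0 + join_coords e 0 u - 0)) (at x)"
    by (intro derivative_intros assms
        bounded_linear.has_derivative[OF bounded_linear_join_coords_left]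
        bounded_linear.has_derivative[OF bounded_linear_join_coords_right])
  then show ?thesis
    unfolding alpha_def by (simp flip: join_coords_split)
qed

text \<open>This is the derivative of \<alpha>, block triangular after reordering. A kernel vector
  vanishes outside \<open>range e\<close> by the identity block; what remains is a linear relation
  among the selected columns, which are independent.\<close>

lemma admissible_reordering_inj_join_coords:
  fixes J :: "real ^ 'd ^ 'k"
  assumes "admissible_reordering J e"
  shows "inj (\<lambda>u. join_coords e (J *v u) u)"
proof -
  define c where "c = (\<lambda>k. column (e k) J)"
  have e: "inj e" "inj c" "independent (range c)"
    using assms by (auto simp: admissible_reordering_def c_def)
  let ?L = "\<lambda>u. join_coords e (J *v u) u"
  have "linear ?L"
    by (auto intro!: linearI simp: join_coords_def vec_eq_iff matrix_vector_right_distrib matrix_vector_mult_scaleR)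
  moreover have "u = 0" if u: "?L u = 0" for u
  proof -
    have comp: "?L u $ j = 0" for j by (simp add: u)
    have outside: "u $ j = 0" if "j \<notin> range e" for j
      using comp[of j] that by (simp add: join_coords_def)
    have "J *v u = 0"
      using comp[of "e _"] e(1) by (simp add: join_coords_def vec_eq_iff)
    then have "0 = (\<Sum>j\<in>UNIV. u $ j *\<^sub>R column j J)"
      by (simp add: matrix_mult_sum scalar_mult_eq_scaleR)
    also have "\<dots> = (\<Sum>j\<in>range e. u $ j *\<^sub>R column j J)"
      using outside by (intro sum.mono_neutral_right) auto
    also have "\<dots> = (\<Sum>k\<in>UNIV. u $ e k *\<^sub>R c k)"
      by (simp add: sum.reindex[OF e(1)] c_def)
    \<comment> \<open>Independence speaks of a set of vectors, so the sum is reindexed by the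
      columns themselves; injectivity of \<open>c\<close> ensures that no coefficients are
      merged.\<close>
    also have "\<dots> = (\<Sum>b\<in>range c. u $ e (inv c b) *\<^sub>R b)"
      by (simp add: sum.reindex[OF e(2)] inv_f_f[OF e(2)])
    finally have "u $ e (inv c b) = 0" if "b \<in> range c" for b
      using independentD[OF e(3) _ subset_refl, of "\<lambda>b. u $ e (inv c b)" b] that by simp
    then have "u $ e k = 0" for k
      using e(2) by (metis inv_f_f rangeI)
    then show "u = 0"
      using outside by (metis imageE vec_eq_iff zero_index)
  qed
  ultimately show ?thesis
    using linear_injective_0 by blast
qed

text \<open>A basis of the column space can be chosen among the columns. By the rank it has
  \<open>CARD('k)\<close> members, so it can be indexed by \<open>'k\<close>, and \<open>e\<close>
  picks a position for each.\<close>

lemma admissible_reordering_exists: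
  fixes J :: "real ^ 'd ^ 'k"
  assumes "rank J = CARD('k)"
  obtains e where "admissible_reordering J e"
proof -
  obtain B where B: "B \<subseteq> columns J" "independent B" "card B = dim (columns J)"
    by (rule basis_exists)
  have "finite B" using B(2) independent_imp_finite by blast
  moreover have "card B = CARD('k)"
    using B(3) assms by (simp add: column_rank_def)
  ultimately obtain h where h: "bij_betw h (UNIV :: 'k set) B"
    using finite_same_card_bij[of "UNIV :: 'k set" B] by auto
  then have "h k \<in> columns J" for k
    using B(1) bij_betw_apply by fastforce
  then have "\<exists>j. h k = column j J" for k
    by (simp add: columns_def)
  then obtain e where e: "\<And>k. column (e k) J = h k" by metis
  have "inj h" "range h = B" using h by (auto simp: bij_betw_def)
  moreover from \<open>inj h\<close> have "inj e"
    using e by (metis injD injI)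
  ultimately have "admissible_reordering J e"
    using B(2) e by (simp add: admissible_reordering_def)
  then show thesis using that by blast
qed

lemma smooth_on_stacked:
  assumes "\<And>x. x \<in> range xs \<Longrightarrow> smooth_on UNIV (\<lambda>v. f v x)"
  shows "smooth_on UNIV (stacked f xs)"
  unfolding smooth_on_def n_times_differentiable_on_vec[OF open_UNIV] stacked_def vec_lambda_beta
  using assms by (intro allI n_times_differentiable_on_linear[OF bounded_linear_vec_nth open_UNIV])
    (simp add: smooth_on_def)

lemma alpha_local_diffeo:
  fixes F :: "real ^ 'd \<Rightarrow> real ^ 'k::finite"
  assumes F: "smooth_on UNIV F" and e: "admissible_reordering (jacobian F (at p)) e"
  obtains U where "p \<in> U" "diffeo_onto_image U (\<lambda>v. alpha F e v - c)"
proof (rule smooth_inverse_function_theorem[OF open_UNIV UNIV_I smooth_on_alpha[OF F]])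
  have "F differentiable (at p)"
    using F n_times_differentiable_on.simps(2)[of 0 UNIV F] unfolding smooth_on_def by blast
  then have "(F has_derivative (*v) (jacobian F (at p))) (at p)"
    by (simp add: jacobian_works)
  from frechet_derivative_at[OF has_derivative_alpha[OF this]]
  show "inj (frechet_derivative (\<lambda>v. alpha F e v - c) (at p))"
    using admissible_reordering_inj_join_coords[OF e] by simp
qed (rule that)

section \<open>Adapted charts for the two sets\<close>

lemma embedded_submanifold_level_set:
  fixes F :: "real ^ 'd \<Rightarrow> real ^ 'k::finite"
  assumes F: "smooth_on UNIV F" and rank: "\<And>p. F p = q \<Longrightarrow> rank (jacobian F (at p)) = CARD('k)"
  shows "embedded_submanifold {p. F p = q}"
  unfolding embedded_submanifold_def embedded_submanifold_of_dim_def
\<comment> \<open>The dimension is fixed before the point: \<open>e\<close> may vary with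
  \<open>p\<close>, but the number of coordinates outside \<open>range e\<close> does not.\<close>
proof (rule exI, rule ballI)
  fix p assume "p \<in> {p. F p = q}"
  then obtain e where e: "admissible_reordering (jacobian F (at p)) e"
    using admissible_reordering_exists[OF rank] by blast
  then have "inj e" by (simp add: admissible_reordering_def)
  obtain U where U: "p \<in> U" "diffeo_onto_image U (\<lambda>v. alpha F e v - join_coords e q 0)"
    using alpha_local_diffeo[OF F e] .
  \<comment> \<open>At position \<open>e k\<close> the translated chart reads
    \<open>F v $ k - q $ k\<close>; elsewhere it reads \<open>v $ j\<close>, a free coordinate.
    Hence \<open>K\<close> is the complement of \<open>range e\<close>.\<close>
  have "F v = q \<longleftrightarrow> (\<forall>j. j \<notin> - range e \<longrightarrow> (alpha F e v - join_coords e q 0) $ j = 0)" for v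
    using \<open>inj e\<close> by (auto simp: alpha_def join_coords_def vec_eq_iff) (metis inv_f_f rangeI)
  moreover have "card (- range e) = CARD('d) - CARD('k)"
    using \<open>inj e\<close> card_Diff_subset[of "range e" UNIV]
    by (simp only: Compl_eq_Diff_UNIV card_image finite subset_UNIV)
  ultimately show "\<exists>U (\<phi> :: real ^ 'd \<Rightarrow> real ^ 'd) K. p \<in> U \<and> diffeo_onto_image U \<phi> \<and> card K = CARD('d) - CARD('k) \<and>
        U \<inter> {p. F p = q} = {x \<in> U. \<forall>j. j \<notin> K \<longrightarrow> \<phi> x $ j = 0}"
    using U by (intro exI[of _ U] exI[of _ "\<lambda>v. alpha F e v - join_coords e q 0"] exI[of _ "- range e"]) blast
qed

text \<open>The set lies in \<open>W\<close> and is there the preimage under \<alpha> of the slice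
  whose coordinates outside \<open>range e\<close> vanish. So the single chart \<alpha> on
  \<open>W\<close> serves every point, with \<open>K = range e\<close>.\<close>

lemma embedded_submanifold_unique_predictions:
  fixes F :: "real ^ 'd \<Rightarrow> real ^ 'k::finite"
  assumes "inj e" and W: "diffeo_onto_image W (alpha F e)"
  shows "embedded_submanifold (unique_predictions F e W)"
  unfolding embedded_submanifold_def embedded_submanifold_of_dim_def
proof (intro exI ballI conjI)
  have inj: "inj_on (alpha F e) W"
    using W by (simp add: diffeo_onto_image_def)
  have inv: "the_inv_into W (alpha F e) (alpha F e x) = x" if "x \<in> W" for x
    using the_inv_into_f_f[OF inj that] .
  \<comment> \<open>This supplies the witness for membership: a point \<open>x\<close> of the slice
    arises from the prediction vector \<open>F x\<close>.\<close>
  have "alpha F e x = join_coords e (F x) 0" if "\<forall>j. j \<notin> range e \<longrightarrow> alpha F e x $ j = 0" for x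
    using that by (auto simp: alpha_def join_coords_def vec_eq_iff)
  moreover have "join_coords e p 0 $ j = 0" if "j \<notin> range e" for p and j
    using that by (simp add: join_coords_def)
  ultimately have eq: "unique_predictions F e W = {x \<in> W. \<forall>j. j \<notin> range e \<longrightarrow> alpha F e x $ j = 0}"
    unfolding unique_predictions_def using inv by (auto; metis (no_types, lifting) imageI)
  show "card (range e) = CARD('k)"
    using \<open>inj e\<close> by (rule card_image)
  fix p assume "p \<in> unique_predictions F e W"
  then show "p \<in> W" using eq by blast
  show "diffeo_onto_image W (alpha F e)" by (rule W)
  show "W \<inter> unique_predictions F e W = {x \<in> W. \<forall>j. j \<notin> range e \<longrightarrow> alpha F e x $ j = 0}"
    using eq by blast
qed

theorem theorem4p6:
  fixes f :: "real ^ 'd \<Rightarrow> real ^ 'i \<Rightarrow> real ^ 'o"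
    and xs :: "'n::finite \<Rightarrow> real ^ 'i"
    and w :: "real ^ 'd"
  assumes smooth: "\<And>x. x \<in> range xs \<Longrightarrow> smooth_on UNIV (\<lambda>v. f v x)"
    and overparametrized: "CARD('d) > CARD('n) * CARD('o)"
    and full_rank: "\<And>v. rank (jacobian (stacked f xs) (at v)) = CARD('n) * CARD('o)"
  shows "embedded_submanifold (same_predictions f (range xs) w) \<and>
    (\<exists>e. admissible_reordering (jacobian (stacked f xs) (at w)) e) \<and>
    (\<forall>e. admissible_reordering (jacobian (stacked f xs) (at w)) e \<longrightarrow>
       (\<exists>W. alpha_domain (stacked f xs) e w W) \<and>
       (\<forall>W. alpha_domain (stacked f xs) e w W \<longrightarrow>
          embedded_submanifold (unique_predictions (stacked f xs) e W)))"
proof (intro conjI allI impI)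
  let ?F = "stacked f xs"
  have F: "smooth_on UNIV ?F"
    using smooth by (rule smooth_on_stacked)
  have rank: "rank (jacobian ?F (at v)) = CARD('n \<times> 'o)" for v
    using full_rank by simp
  \<comment> \<open>Equal predictions on all data means equal stacked vectors, so this is the level
    set of \<open>?F\<close> through \<open>w\<close>.\<close>
  have "same_predictions f (range xs) w = {v. ?F v = ?F w}"
    by (auto simp: same_predictions_def stacked_def vec_eq_iff)
  then show "embedded_submanifold (same_predictions f (range xs) w)"
    using embedded_submanifold_level_set[OF F rank] by simp
  show "\<exists>e. admissible_reordering (jacobian ?F (at w)) e"
    using admissible_reordering_exists[OF rank] by blast
  fix e assume e: "admissible_reordering (jacobian ?F (at w)) e"
  show "\<exists>W. alpha_domain ?F e w W"
    using alpha_local_diffeo[OF F e, of 0] by (auto simp: alpha_domain_def)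
  fix W assume "alpha_domain ?F e w W"
  then show "embedded_submanifold (unique_predictions ?F e W)"
    using e by (intro embedded_submanifold_unique_predictions)
      (auto simp: alpha_domain_def admissible_reordering_def)
qed

end
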